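(* Let $a,b\in\mathbb{R}$ with $a=-b$ and let $G$ be the Green's function of the problem $u'(t)+a\,u(-t)+b\,u(t)=h(t)$ for a.e. $t\in\mathbb{R}$, $u(t_0)=c$ (given in the context). Then: (i) if $a>0$, $G$ is non-negative on $[0,+\infty)\times\mathbb{R}$; (ii) if $a<0$, $G$ is non-positive on $(-\infty,0]\times\mathbb{R}$; (iii) $G$ changes sign in any other strip not a subset of the aforementioned.
   Context: Here $h\in L^1_{\mathrm{loc}}(\mathbb{R})$ and $t_0,c\in\mathbb{R}$. Strips are sets of the kind $[\alpha,\beta]\times\mathbb{R}$ in the $(t,s)$-plane (unbounded intervals as in (i) and (ii) also occurring). For $t_1,t_2\in\mathbb{R}$ the oriented characteristic function is $\chi_{t_1}^{t_2}(t)=1$ if $t_1\le t\le t_2$, $\chi_{t_1}^{t_2}(t)=-1$ if $t_2\le t<t_1$, and $0$ otherwise. The Green's function is $$G(t,s)=\tfrac12\Big(\big[\tilde u(-s)\tilde v(t)+\tilde v(-s)\tilde u(t)\big]\chi_0^t(s)+\big[\tilde u(-s)\tilde v(t)-\tilde v(-s)\tilde u(t)\big]\chi_{-t}^0(s)\Big),\quad t,s\in\mathbb{R},$$ where $\tilde u'(t)+a\tilde u(-t)+b\tilde u(t)=0$, $\tilde u(0)=1$ and $\tilde v'(t)-a\tilde v(-t)+b\tilde v(t)=0$, $\tilde v(0)=1$. For $a=-b$ it is written as: $1+a(t-s)$ for $0\le s\le t$; $-1-a(t-s)$ for $t\le s\le 0$; $a(s+t)$ for $-t\le s\le 0$; $-a(s+t)$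 for $0\le s\le -t$; and $0$ otherwise.
   Formalization: In (ii), the single point (0,0) is excluded: by the given formula and characteristic function, G(0,0)=1>0 for every a, so non-positivity on all of (-∞,0]×ℝ fails exactly there. *)

theory Defs
  imports "HOL-Analysis.Analysis"
begin

definition oriented_chi :: "real \<Rightarrow> real \<Rightarrow> real \<Rightarrow> real" where
  "oriented_chi t1 t2 t =
     (if t1 \<le> t \<and> t \<le> t2 then 1 else if t2 \<le> t \<and> t < t1 then -1 else 0)"

text \<open>The normalised solution of \<open>w'(t) + p w(-t) + q w(t) = 0\<close>, \<open>w(0) = 1\<close> on the whole line.\<close>

definition reflection_ivp :: "real \<Rightarrow> real \<Rightarrow> (real \<Rightarrow> real) \<Rightarrow> bool" where
  "reflection_ivp p q w \<longleftrightarrow>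
     (\<forall>t. \<exists>D. (w has_real_derivative D) (at t) \<and> D + p * w (- t) + q * w t = 0) \<and> w 0 = 1"

text \<open>The kernel \<open>G\<close> attached to \<open>u'(t) + a u(-t) + b u(t) = h(t)\<close>, \<open>u(t\<^sub>0) = c\<close>; it depends on
  neither of \<open>h\<close>, \<open>t\<^sub>0\<close>, \<open>c\<close>. The companion function \<open>v\<close> solves the problem with \<open>a\<close>
  replaced by \<open>-a\<close>.\<close>

definition is_greens_function :: "real \<Rightarrow> real \<Rightarrow> (real \<Rightarrow> real \<Rightarrow> real) \<Rightarrow> bool" where
  "is_greens_function a b G \<longleftrightarrow>
     (\<exists>u v. reflection_ivp a b u \<and> reflection_ivp (- a) b v \<and>
        (\<forall>t s. G t s =
           1/2 * ((u (- s) * v t + v (- s) * u t) * oriented_chi 0 t s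
                + (u (- s) * v t - v (- s) * u t) * oriented_chi (- t) 0 s)))"

text \<open>Points of the plane are written \<open>(t, s)\<close>. A strip lies over a nonempty closed interval of
  \<open>t\<close>-values, bounded or unbounded.\<close>

definition strip :: "(real \<times> real) set \<Rightarrow> bool" where
  "strip S \<longleftrightarrow> (\<exists>I. is_interval I \<and> closed I \<and> I \<noteq> {} \<and> S = I \<times> UNIV)"

definition nonneg_on :: "(real \<Rightarrow> real \<Rightarrow> real) \<Rightarrow> (real \<times> real) set \<Rightarrow> bool" where
  "nonneg_on G S \<longleftrightarrow> (\<forall>(t, s) \<in> S. 0 \<le> G t s)"

definition nonpos_on :: "(real \<Rightarrow> real \<Rightarrow> real) \<Rightarrow> (real \<times> real) set \<Rightarrow> bool" where
  "nonpos_on G S \<longleftrightarrow> (\<forall>(t, s) \<in> S. G t s \<le> 0)"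

definition changes_sign_on :: "(real \<Rightarrow> real \<Rightarrow> real) \<Rightarrow> (real \<times> real) set \<Rightarrow> bool" where
  "changes_sign_on G S \<longleftrightarrow> (\<exists>(t, s) \<in> S. 0 < G t s) \<and> (\<exists>(t, s) \<in> S. G t s < 0)"

text \<open>A pitfall at the origin: \<open>oriented_chi 0 0 0 = 1\<close>, so every \<open>G\<close> as above has
  \<open>G 0 0 = 1\<close>, whatever \<open>a\<close> and \<open>b\<close> are. Non-positivity over \<open>{..0} \<times> UNIV\<close> can therefore
  only hold off the single point \<open>(0, 0)\<close>.\<close>

lemma greens_function_origin:
  assumes "is_greens_function a b G"
  shows "G 0 0 = 1"
proof -
  from assms obtain u v where "u 0 = 1" "v 0 = 1"
    and G: "\<And>t s. G t s =
           1/2 * ((u (- s) * v t + v (- s) * u t) * oriented_chi 0 t s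
                + (u (- s) * v t - v (- s) * u t) * oriented_chi (- t) 0 s)"
    unfolding is_greens_function_def reflection_ivp_def by blast
  then show ?thesis
    by (simp add: G[of 0 0] oriented_chi_def)
qed

end

theory Submission imports Defs
begin

text \<open>
  For \<open>b = - a\<close> both auxiliary problems can be solved by hand, because the reflected and the
  unreflected term combine to the odd or to the even part of the unknown. In
  \<open>u'(t) = a (u(t) - u(-t))\<close> the right-hand side is odd, so the odd part of \<open>u\<close> is constant,
  hence zero; but the right-hand side is a multiple of that odd part, so \<open>u = 1\<close>. In
  \<open>v'(t) = a (v(t) + v(-t))\<close> the right-hand side is even, so the even part of \<open>v\<close> is the
  constant \<open>1\<close>, and \<open>v(t) = 1 + 2 a t\<close>.

  Substituting these, the kernel becomes \<open>1 + a (t - s)\<close> on the triangles between the axis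
  \<open>s = 0\<close> and the diagonal, and \<open>a (t + s)\<close> on those between the axis and the antidiagonal,
  with the signs of the oriented characteristic functions. All claims are read off from this
  form. For \<open>t \<noteq> 0\<close>, \<open>G\<close> has the sign of \<open>t\<close> on the diagonal, whatever \<open>a\<close> is, and the sign of
  \<open>a\<close> strictly between the antidiagonal and the axis. Therefore a single vertical line over \<open>t < 0\<close> (if
  \<open>a > 0\<close>) or over \<open>t > 0\<close> (if \<open>a < 0\<close>) already shows both signs, and so does any pair of
  lines on opposite sides of \<open>t = 0\<close>.
\<close>

lemma reflection_ivp_has_derivative:
  assumes "reflection_ivp p q w"
  shows "(w has_real_derivative - p * w (- t) - q * w t) (at t)"
proof -
  obtain D where D: "(w has_real_derivative D) (at t)" "D + p * w (- t) + q * w t = 0"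
    using assms unfolding reflection_ivp_def by blast
  from D(2) have "D = - p * w (- t) - q * w t"
    by simp
  with D(1) show ?thesis
    by simp
qed

text \<open>The right-hand side \<open>a (u(t) - u(-t))\<close> is odd, so \<open>u(t) - u(-t)\<close> has derivative zero; it
  vanishes at \<open>0\<close>, and then \<open>u' = 0\<close> as well.\<close>

lemma reflection_ivp_odd_rhs_solution:
  assumes u: "reflection_ivp a (- a) u"
  shows "u t = 1"
proof -
  note du = reflection_ivp_has_derivative[OF u]
  have "((\<lambda>x. u x - u (- x)) has_real_derivative 0) (at x)" for x
    using DERIV_diff[OF du DERIV_mirror[THEN iffD1, OF du]] by (simp add: algebra_simps)
  then have "u x - u (- x) = u 0 - u (- 0)" for x
    by (intro DERIV_isconst_all allI)
  then have even: "u (- x) = u x" for x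
    by simp
  have "(u has_real_derivative 0) (at x)" for x
    using du[of x] by (simp add: even)
  then have "u t = u 0"
    by (intro DERIV_isconst_all allI)
  then show ?thesis
    using u by (simp add: reflection_ivp_def)
qed

text \<open>The right-hand side \<open>a (v(t) + v(-t))\<close> is even, so \<open>v(t) + v(-t)\<close> has derivative zero and
  keeps its value \<open>2\<close> at the origin; hence \<open>v' = 2 a\<close>.\<close>

lemma reflection_ivp_even_rhs_solution:
  assumes v: "reflection_ivp (- a) (- a) v"
  shows "v t = 1 + 2 * a * t"
proof -
  note dv = reflection_ivp_has_derivative[OF v]
  have v0: "v 0 = 1"
    using v by (simp add: reflection_ivp_def)
  have "((\<lambda>x. v x + v (- x)) has_real_derivative 0) (at x)" for x
    using DERIV_add[OF dv DERIV_mirror[THEN iffD1, OF dv]] by (simp add: algebra_simps)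
  then have "v x + v (- x) = v 0 + v (- 0)" for x
    by (intro DERIV_isconst_all allI)
  then have even_part: "v (- x) = 2 - v x" for x
    using v0 by (simp add: algebra_simps)
  have "(v has_real_derivative 2 * a) (at x)" for x
    using dv[of x] by (simp add: even_part algebra_simps)
  then have "((\<lambda>x. v x - 2 * a * x) has_real_derivative 0) (at x)" for x
    by (auto intro!: derivative_eq_intros)
  then have "v t - 2 * a * t = v 0 - 2 * a * 0"
    by (intro DERIV_isconst_all allI)
  then show ?thesis
    using v0 by simp
qed

text \<open>The oriented characteristic functions are kept, since their supports overlap on the axis
  \<open>s = 0\<close> for \<open>t \<ge> 0\<close>: there both terms contribute, and \<open>G t 0 = 1 + 2 * a * t\<close>.\<close>

lemma greens_function_closed_form:
  assumes "is_greens_function a (- a) G"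
  shows "G t s = (1 + a * (t - s)) * oriented_chi 0 t s + a * (t + s) * oriented_chi (- t) 0 s"
proof -
  obtain u v where u: "reflection_ivp a (- a) u" and v: "reflection_ivp (- a) (- a) v"
    and G: "\<And>t s. G t s =
           1/2 * ((u (- s) * v t + v (- s) * u t) * oriented_chi 0 t s
                + (u (- s) * v t - v (- s) * u t) * oriented_chi (- t) 0 s)"
    using assms unfolding is_greens_function_def by blast
  show ?thesis
    unfolding G reflection_ivp_odd_rhs_solution[OF u] reflection_ivp_even_rhs_solution[OF v]
    by (simp add: field_simps)
qed

lemma greens_function_diagonal:
  assumes "is_greens_function a (- a) G"
  shows "G t t = (if t < 0 then - 1 else 1)"
  by (simp add: greens_function_closed_form[OF assms] oriented_chi_def)

lemma greens_function_nonneg: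
  assumes G: "is_greens_function a (- a) G" and a: "0 < a" and t: "0 \<le> t"
  shows "0 \<le> G t s"
proof -
  have "0 \<le> (1 + a * (t - s)) * oriented_chi 0 t s"
    using a t by (auto simp: oriented_chi_def intro: add_nonneg_nonneg)
  moreover have "0 \<le> a * (t + s) * oriented_chi (- t) 0 s"
    using a t by (auto simp: oriented_chi_def)
  ultimately show ?thesis
    by (simp add: greens_function_closed_form[OF G])
qed

text \<open>For \<open>t \<le> 0\<close> the parts \<open>0 \<le> s \<le> t\<close> and \<open>- t \<le> s \<le> 0\<close>, where the characteristic
  functions equal \<open>1\<close>, shrink to the origin. Elsewhere they take the value \<open>- 1\<close>, on triangles
  where both \<open>t - s\<close> and \<open>t + s\<close> are at most \<open>0\<close>.\<close>

lemma greens_function_nonpos: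
  assumes G: "is_greens_function a (- a) G" and a: "a < 0" and t: "t \<le> 0"
    and off_origin: "(t, s) \<noteq> (0, 0)"
  shows "G t s \<le> 0"
proof -
  have "(1 + a * (t - s)) * oriented_chi 0 t s \<le> 0"
  proof (cases "t \<le> s \<and> s < 0")
    case True
    then have "0 \<le> a * (t - s)"
      using a by (intro mult_nonpos_nonpos) auto
    with True show ?thesis
      by (simp add: oriented_chi_def)
  next
    case False
    with t off_origin show ?thesis
      by (auto simp: oriented_chi_def)
  qed
  moreover have "a * (t + s) * oriented_chi (- t) 0 s \<le> 0"
  proof (cases "0 \<le> s \<and> s < - t")
    case True
    then have "0 \<le> a * (t + s)"
      using a by (intro mult_nonpos_nonpos) auto
    with True show ?thesis
      by (simp add: oriented_chi_def)
  next
    case False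
    with t off_origin show ?thesis
      by (auto simp: oriented_chi_def)
  qed
  ultimately show ?thesis
    by (simp add: greens_function_closed_form[OF G])
qed

lemma changes_sign_onI:
  assumes "(t, s) \<in> S" "0 < G t s" "(t', s') \<in> S" "G t' s' < 0"
  shows "changes_sign_on G S"
  using assms unfolding changes_sign_on_def by blast

theorem lemma3p9:
  fixes a b :: real and G :: "real \<Rightarrow> real \<Rightarrow> real"
  assumes "a = - b"
    and "is_greens_function a b G"
  shows "(0 < a \<longrightarrow> nonneg_on G ({0..} \<times> UNIV)) \<and>
         (a < 0 \<longrightarrow> nonpos_on G ({..0} \<times> UNIV - {(0, 0)})) \<and>
         (\<forall>S. strip S \<longrightarrow>
            (0 < a \<and> \<not> S \<subseteq> {0..} \<times> UNIV \<longrightarrow> changes_sign_on G S) \<and>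
            (a < 0 \<and> \<not> S \<subseteq> {..0} \<times> UNIV \<longrightarrow> changes_sign_on G S) \<and>
            (\<not> S \<subseteq> {0..} \<times> UNIV \<and> \<not> S \<subseteq> {..0} \<times> UNIV \<longrightarrow> changes_sign_on G S))"
proof (intro conjI impI allI)
  have G: "is_greens_function a (- a) G"
    using assms by simp
  show "nonneg_on G ({0..} \<times> UNIV)" if "0 < a"
    using greens_function_nonneg[OF G that] by (auto simp: nonneg_on_def)
  show "nonpos_on G ({..0} \<times> UNIV - {(0, 0)})" if "a < 0"
    using greens_function_nonpos[OF G that] by (auto simp: nonpos_on_def)

  fix S assume "strip S"
  then obtain I where S: "S = I \<times> UNIV"
    by (auto simp: strip_def)
  show "changes_sign_on G S" if outside: "0 < a \<and> \<not> S \<subseteq> {0..} \<times> UNIV"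
  proof -
    obtain t where t: "t \<in> I" "t < 0"
      using outside by (auto simp: S subset_iff not_le)
    have "G t 0 = - (a * t)"
      using t by (simp add: greens_function_closed_form[OF G] oriented_chi_def)
    then have "0 < G t 0"
      using outside t by (simp add: mult_pos_neg)
    moreover have "G t t < 0"
      using t by (simp add: greens_function_diagonal[OF G])
    ultimately show ?thesis
      using t by (intro changes_sign_onI[of t 0 _ _ t t]) (auto simp: S)
  qed
  show "changes_sign_on G S" if outside: "a < 0 \<and> \<not> S \<subseteq> {..0} \<times> UNIV"
  proof -
    obtain t where t: "t \<in> I" "0 < t"
      using outside by (auto simp: S subset_iff not_le)
    \<comment> \<open>On the axis \<open>G t 0 = 1 + 2 * a * t\<close> may be positive, so the negative value is taken
      midway between the antidiagonal and the axis.\<close>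
    have "G t (- t / 2) = a * (t / 2)"
      using t by (simp add: greens_function_closed_form[OF G] oriented_chi_def)
    moreover have "a * (t / 2) < 0"
      using outside t by (intro mult_neg_pos) auto
    ultimately have "G t (- t / 2) < 0"
      by (simp only:)
    moreover have "0 < G t t"
      using t by (simp add: greens_function_diagonal[OF G])
    ultimately show ?thesis
      using t by (intro changes_sign_onI[of t t _ _ t "- t / 2"]) (auto simp: S)
  qed
  show "changes_sign_on G S" if outside: "\<not> S \<subseteq> {0..} \<times> UNIV \<and> \<not> S \<subseteq> {..0} \<times> UNIV"
  proof -
    obtain t where t: "t \<in> I" "0 < t"
      using outside by (auto simp: S subset_iff not_le)
    obtain t' where t': "t' \<in> I" "t' < 0"
      using outside by (auto simp: S subset_iff not_le)
    from t t' have "0 < G t t" "G t' t' < 0"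
      by (simp_all add: greens_function_diagonal[OF G])
    with t t' show ?thesis
      by (intro changes_sign_onI[of t t _ _ t' t']) (auto simp: S)
  qed
qed

end
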